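(* Every delegation game with effortless voting has a pure-strategy Nash equilibrium. That is, let $N=\{1,\dots,n\}$ be a finite set of agents with network $R\subseteq N^2$, independent random types with $x_i=\mathbb P(\tau(i)=1)\in[0,1]$, accuracies $q_i\in[0.5,1]$, and efforts $e_i=0$ for all $i\in N$. Then there is a profile $\mathbf d\in\prod_{i\in N}\Sigma_i$ such that $u_i(\mathbf d)\ge u_i((\mathbf d_{-i},j))$ for every $i\in N$ and every $j\in\Sigma_i$.
   Context: Agents and network: $N=\{1,\dots,n\}$ is a finite set of agents, $R\subseteq N^2$ is a directed graph, and $R(i)=\{j:(i,j)\in R\}$ is the neighborhood of $i$. The strategy set of agent $i$ is $\Sigma_i=\{i\}\cup R(i)$: choosing $i$ means voting directly, choosing $j\neq i$ means delegating to the neighbor $j$. Delegation profiles: a delegation profile is a vector $\mathbf d=\langle d_1,\dots,d_n\rangle\in N^n$, also seen as the map $\mathbf d:N\to N$, $i\mapsto d_i$. If iterating $\mathbf d$ from $i$ reaches a fixed point, this fixed point is denoted $d_i^*$ and called $i$'s guru. $N^*\subseteq N$ is the set of agents for which $d_i^*$ exists (i.e. whose delegation path does not end in a cycle of length at least 2). $(\mathbf d_{-i},j)$ denotes $\mathbf d$ with its $i$-th entry replaced by $j$. Accuracy and effort: each agent $i$ has an accuracy $q_i\in[0.5,1]$ and an effort $e_i$; effortless voting means $e_i=0$ for all $i\in N$. Types: types are independent $\{0,1\}$-valued random variables $\tau(i)$. With $x_i=\mathbb P(\tau(i)=1)$, the proximity of two distinct agents $i\ne j$ is $p_{i,j}=\mathbb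 P(\tau(i)=\tau(j))=x_ix_j+(1-x_i)(1-x_j)$, and $p_{i,i}=1$. (Degenerate distributions are allowed.) Individual accuracy under $\mathbf d$: $q_i^*(\mathbf d)=q_{d_i^*}\,p_{i,d_i^*}+(1-q_{d_i^*})(1-p_{i,d_i^*})$ if $i\in N^*$, and $q_i^*(\mathbf d)=0.5$ if $i\notin N^*$. (In particular $q_i^*(\mathbf d)=q_i$ if $d_i=i$.) Utility: $u_i(\mathbf d)=q_i^*(\mathbf d)$ if $d_i\ne i$, and $u_i(\mathbf d)=q_i-e_i$ if $d_i=i$. The delegation game is the strategic game with players $N$, strategy sets $\Sigma_i$ and utilities $u_i$. *)

theory Defs
  imports "HOL-Probability.Probability"
begin

text \<open>A strategic game is given by its set of players \<open>P\<close>, the strategy sets \<open>S\<close> and the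
  utilities \<open>u\<close>. Profiles are extensional functions on \<open>P\<close>.\<close>

definition pure_nash_equilibrium ::
  "'i set \<Rightarrow> ('i \<Rightarrow> 's set) \<Rightarrow> ('i \<Rightarrow> ('i \<Rightarrow> 's) \<Rightarrow> real) \<Rightarrow> ('i \<Rightarrow> 's) \<Rightarrow> bool" where
  "pure_nash_equilibrium P S u d \<longleftrightarrow>
     d \<in> Pi\<^sub>E P S \<and> (\<forall>i\<in>P. \<forall>j\<in>S i. u i d \<ge> u i (d(i := j)))"

definition strategies :: "('a \<times> 'a) set \<Rightarrow> 'a \<Rightarrow> 'a set" where
  "strategies R i = insert i (R `` {i})"

definition is_guru :: "('a \<Rightarrow> 'a) \<Rightarrow> 'a \<Rightarrow> 'a \<Rightarrow> bool" where
  "is_guru d i g \<longleftrightarrow> (\<exists>k. (d ^^ k) i = g) \<and> d g = g"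

text \<open>\<open>guru d i\<close> is only meaningful if the delegation path of \<open>i\<close> reaches a fixed point.\<close>

definition guru :: "('a \<Rightarrow> 'a) \<Rightarrow> 'a \<Rightarrow> 'a" where
  "guru d i = (THE g. is_guru d i g)"

definition agents_with_guru :: "'a set \<Rightarrow> ('a \<Rightarrow> 'a) \<Rightarrow> 'a set" where
  "agents_with_guru N d = {i \<in> N. \<exists>g. is_guru d i g}"

lemma is_guru_unique:
  assumes "is_guru d i g" "is_guru d i h"
  shows "g = h"
proof -
  have fix_iter: "(d ^^ m) x = x" if "d x = x" for m x
    using that by (induction m) auto
  obtain k l where k: "(d ^^ k) i = g" "d g = g" and l: "(d ^^ l) i = h" "d h = h"
    using assms unfolding is_guru_def by blast
  have "(d ^^ (l + k)) i = g"
    using k fix_iter[of g l] by (simp add: funpow_add)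
  moreover have "(d ^^ (k + l)) i = h"
    using l fix_iter[of h k] by (simp add: funpow_add)
  ultimately show ?thesis
    by (simp add: add.commute)
qed

lemma guru_eqI: "is_guru d i g \<Longrightarrow> guru d i = g"
  unfolding guru_def by (blast intro: the_equality is_guru_unique)

definition proximity :: "'w measure \<Rightarrow> ('a \<Rightarrow> 'w \<Rightarrow> nat) \<Rightarrow> 'a \<Rightarrow> 'a \<Rightarrow> real" where
  "proximity M \<tau> i j = measure M {\<omega> \<in> space M. \<tau> i \<omega> = \<tau> j \<omega>}"

definition individual_accuracy ::
  "'a set \<Rightarrow> 'w measure \<Rightarrow> ('a \<Rightarrow> 'w \<Rightarrow> nat) \<Rightarrow> ('a \<Rightarrow> real) \<Rightarrow> ('a \<Rightarrow> 'a) \<Rightarrow> 'a \<Rightarrow> real" where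
  "individual_accuracy N M \<tau> q d i =
     (if i \<in> agents_with_guru N d
      then q (guru d i) * proximity M \<tau> i (guru d i)
           + (1 - q (guru d i)) * (1 - proximity M \<tau> i (guru d i))
      else 1 / 2)"

definition utility ::
  "'a set \<Rightarrow> 'w measure \<Rightarrow> ('a \<Rightarrow> 'w \<Rightarrow> nat) \<Rightarrow> ('a \<Rightarrow> real) \<Rightarrow> ('a \<Rightarrow> real)
    \<Rightarrow> 'a \<Rightarrow> ('a \<Rightarrow> 'a) \<Rightarrow> real" where
  "utility N M \<tau> q e i d =
     (if d i = i then q i - e i else individual_accuracy N M \<tau> q d i)"

lemma proximity_self:
  assumes "prob_space M"
  shows "proximity M \<tau> i i = 1"
  using prob_space.prob_space[OF assms] by (simp add: proximity_def)

lemma proximity_indep: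
  fixes M :: "'w measure" and \<tau> :: "'a \<Rightarrow> 'w \<Rightarrow> nat"
  assumes "prob_space M"
    and ind: "prob_space.indep_vars M (\<lambda>_. count_space {0, 1}) \<tau> N"
    and ij: "i \<in> N" "j \<in> N" "i \<noteq> j"
  defines "x \<equiv> \<lambda>k. measure M {\<omega> \<in> space M. \<tau> k \<omega> = 1}"
  shows "proximity M \<tau> i j = x i * x j + (1 - x i) * (1 - x j)"
proof -
  interpret prob_space M by fact
  have meas: "\<tau> k \<in> measurable M (count_space {0, 1})" if "k \<in> N" for k
    using ind that by (auto simp: indep_vars_def)
  have vals: "\<tau> k \<omega> = 0 \<or> \<tau> k \<omega> = 1" if "k \<in> N" "\<omega> \<in> space M" for k \<omega>
    using measurable_space[OF meas[OF that(1)] that(2)] by auto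
  let ?E = "\<lambda>k c. {\<omega> \<in> space M. \<tau> k \<omega> = c}"
  have ev_eq: "?E k c = \<tau> k -` {c} \<inter> space M" for k c
    by auto
  have ev: "?E k c \<in> events" if "k \<in> N" "c \<in> {0, 1}" for k c
    unfolding ev_eq using that by (intro measurable_sets[OF meas]) auto
  have joint: "prob (?E i c \<inter> ?E j c) = prob (?E i c) * prob (?E j c)" if "c \<in> {0, 1}" for c
  proof -
    have "prob (\<Inter>k\<in>{i, j}. \<tau> k -` {c} \<inter> space M)
        = (\<Prod>k\<in>{i, j}. prob (\<tau> k -` {c} \<inter> space M))"
      using ij that by (intro indep_varsD[OF ind]) auto
    then show ?thesis
      using ij by (simp add: ev_eq)
  qed
  have compl: "prob (?E k 0) = 1 - x k" if "k \<in> N" for k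
  proof -
    have "?E k 0 = space M - ?E k 1"
      using vals[OF that] by auto
    then show ?thesis
      using prob_compl[OF ev[OF that, of 1]] by (simp add: x_def)
  qed
  have "{\<omega> \<in> space M. \<tau> i \<omega> = \<tau> j \<omega>} = (?E i 1 \<inter> ?E j 1) \<union> (?E i 0 \<inter> ?E j 0)"
    using vals ij by fastforce
  then have "proximity M \<tau> i j = prob (?E i 1 \<inter> ?E j 1) + prob (?E i 0 \<inter> ?E j 0)"
    unfolding proximity_def using ev ij
    by (simp only:) (rule finite_measure_Union; auto)
  then show ?thesis
    using joint[of 0] joint[of 1] compl ij by (simp add: x_def)
qed

end

theory Submission
  imports Defs
begin

text \<open>
  Put \<open>a\<^sub>i = 2 x\<^sub>i - 1\<close> and \<open>w\<^sub>i = 2 q\<^sub>i - 1\<close>. Up to the affine map \<open>v \<mapsto> (1 + v) / 2\<close>, agent \<open>i\<close>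
  receives \<open>w\<^sub>i\<close> when voting, \<open>a\<^sub>i b\<^sub>g\<close> with \<open>b\<^sub>g = w\<^sub>g a\<^sub>g\<close> when delegating with guru \<open>g\<close>, and
  \<open>0\<close> when caught in a cycle. Call a profile admissible if everybody has a guru and every
  delegator receives a positive amount, at least what voting would give. Switching one agent
  of an admissible profile to a strictly better delegation gives an admissible profile again:
  all agents who reached their guru through him now have a guru of the same sign with
  larger \<open>|b|\<close>. So an admissible profile maximising \<open>\<Sum>\<^sub>i |b\<^bsub>guru(i)\<^esub>|\<close> is an equilibrium.
\<close>

section \<open>Delegation paths and how gurus change under a deviation\<close>

lemma is_guru_self: "d i = i \<Longrightarrow> is_guru d i i"
  unfolding is_guru_def by (metis funpow_0)

lemma is_guru_step: "is_guru d (d i) g \<Longrightarrow> is_guru d i g"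
  unfolding is_guru_def by (metis funpow_Suc_right o_apply)

lemma is_guru_fixed: "is_guru d i g \<Longrightarrow> d g = g"
  by (simp add: is_guru_def)

lemma is_guru_mem:
  assumes "is_guru d i g" "i \<in> A" "\<And>k. k \<in> A \<Longrightarrow> d k \<in> A"
  shows "g \<in> A"
proof -
  have "(d ^^ k) i \<in> A" for k
    by (induction k) (use assms in auto)
  then show ?thesis
    using assms(1) unfolding is_guru_def by blast
qed

text \<open>Induction on the length of the delegation path, from the guru back to its
  predecessors.\<close>

lemma is_guru_induct [consumes 1, case_names fixed step]:
  assumes "is_guru d i g"
    and "d g = g \<Longrightarrow> P g"
    and "\<And>k. is_guru d (d k) g \<Longrightarrow> P (d k) \<Longrightarrow> P k"
  shows "P i"
proof -
  obtain m where m: "(d ^^ m) i = g" and g: "d g = g"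
    using assms(1) unfolding is_guru_def by blast
  from m show ?thesis
  proof (induction m arbitrary: i)
    case 0
    then show ?case using assms(2) g by simp
  next
    case (Suc m)
    then have *: "(d ^^ m) (d i) = g"
      by (simp add: funpow_swap1)
    then have "is_guru d (d i) g"
      using g unfolding is_guru_def by blast
    then show ?case
      using Suc.IH[OF *] assms(3) by blast
  qed
qed

text \<open>If the old path of \<open>k\<close> avoids \<open>i\<close>, the two profiles agree
  along it and \<open>h\<close> survives as guru. If it meets \<open>i\<close>, then
  \<open>h\<close> was the guru of \<open>i\<close> too, and the new path of \<open>k\<close>
  continues from \<open>i\<close> to \<open>g\<close>.\<close>

lemma is_guru_change:
  assumes "is_guru d k h" "is_guru d' i g" and agree: "\<And>k. k \<noteq> i \<Longrightarrow> d' k = d k"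
  shows "is_guru d' k h \<or> is_guru d' k g \<and> is_guru d i h"
  using assms(1)
proof (induction rule: is_guru_induct)
  case fixed
  then show ?case
    using assms(2) agree[of h] is_guru_self[of d h] is_guru_self[of d' h] by (cases "h = i") auto
next
  case (step k)
  then show ?case
    using assms(2) agree[of k] is_guru_step[of d' k] is_guru_step[of d k] by (cases "k = i") auto
qed

section \<open>Normalised payoffs and improving deviations\<close>

definition gain :: "('a \<Rightarrow> real) \<Rightarrow> ('a \<Rightarrow> real) \<Rightarrow> 'a \<Rightarrow> ('a \<Rightarrow> 'a) \<Rightarrow> real" where
  "gain w a i d =
     (if d i = i then w i
      else if \<exists>g. is_guru d i g then a i * (w (guru d i) * a (guru d i))
      else 0)"

text \<open>Strict positivity ties the sign of \<open>w g * a g\<close> to that of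
  \<open>a i\<close>. Hence all delegators to one guru have \<open>a\<close> of the same sign, and a
  guru better for one of them is better for all.\<close>

definition admissible :: "'a set \<Rightarrow> ('a \<Rightarrow> real) \<Rightarrow> ('a \<Rightarrow> real) \<Rightarrow> ('a \<Rightarrow> 'a) \<Rightarrow> bool" where
  "admissible N w a d \<longleftrightarrow>
     (\<forall>i\<in>N. \<exists>g. is_guru d i g \<and>
        (d i \<noteq> i \<longrightarrow> 0 < a i * (w g * a g) \<and> w i \<le> a i * (w g * a g)))"

lemma gain_delegate:
  assumes "is_guru d i g" "d i \<noteq> i"
  shows "gain w a i d = a i * (w g * a g)"
  using assms guru_eqI[OF assms(1)] by (auto simp: gain_def)

text \<open>Comparison with \<open>x\<close> shows that \<open>b\<close> and \<open>c\<close> have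
  the same sign, which is also the sign of \<open>y\<close>. Both products therefore equal the
  products of absolute values.\<close>

lemma same_sign_mult_mono:
  fixes x y b c :: real
  assumes "0 < x * b" "0 < y * b" "0 < x * c" "\<bar>b\<bar> \<le> \<bar>c\<bar>"
  shows "y * b \<le> y * c"
proof -
  have "0 < y * c"
    using assms(1-3) by (auto simp: zero_less_mult_iff)
  then have "y * c = \<bar>y\<bar> * \<bar>c\<bar>" "y * b = \<bar>y\<bar> * \<bar>b\<bar>"
    using assms(2) by (simp_all flip: abs_mult)
  then show ?thesis
    using assms(4) by (simp add: mult_left_mono)
qed

lemma admissible_improvement:
  assumes adm: "admissible N w a d" and i: "i \<in> N"
    and bounds: "\<And>i. i \<in> N \<Longrightarrow> 0 \<le> w i" "\<And>i. i \<in> N \<Longrightarrow> \<bar>a i\<bar> \<le> 1"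
    and better: "gain w a i d < gain w a i (d(i := j))"
  shows "admissible N w a (d(i := j))"
    and "\<And>k. k \<in> N \<Longrightarrow>
      \<bar>w (guru d k) * a (guru d k)\<bar> \<le> \<bar>w (guru (d(i := j)) k) * a (guru (d(i := j)) k)\<bar>"
    and "\<bar>w (guru d i) * a (guru d i)\<bar> < \<bar>w (guru (d(i := j)) i) * a (guru (d(i := j)) i)\<bar>"
proof -
  define b where "b g = w g * a g" for g
  define d' where "d' = d(i := j)"
  obtain h where h: "is_guru d i h"
      "d i \<noteq> i \<Longrightarrow> 0 < a i * b h" "d i \<noteq> i \<Longrightarrow> w i \<le> a i * b h"
    using adm i unfolding admissible_def b_def by blast
  have h_vote: "h = i" if "d i = i"
    using is_guru_unique[OF h(1) is_guru_self[of d i, OF that]] .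
  have gain_d: "gain w a i d = (if d i = i then w i else a i * b h)"
    using gain_delegate[OF h(1)] by (auto simp: gain_def b_def)
  \<comment> \<open>Admissibility makes voting no better than the current choice. A strict
    improvement thus beats the vote and is positive, so it can neither be a vote nor end in a cycle,
    where the gain is 0.\<close>
  have "w i \<le> gain w a i d"
    using gain_d h(3) by auto
  then have pos: "0 < gain w a i d'" "w i < gain w a i d'"
    using better bounds(1)[OF i] unfolding d'_def by auto
  then have ji: "d' i \<noteq> i"
    by (auto simp: gain_def)
  with pos(1) obtain g where g: "is_guru d' i g"
    by (auto simp: gain_def split: if_splits)
  have gain_d': "gain w a i d' = a i * b g"
    using gain_delegate[OF g ji] by (simp add: b_def)
  have gpos: "0 < a i * b g"
    using pos gain_d' by simp
  \<comment> \<open>For a delegator the common factor \<open>\<bar>a i\<bar>\<close> cancels. For a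
    voter \<open>h = i\<close>, and \<open>w i\<close> separates the two values because
    \<open>\<bar>a i\<bar> \<le> 1\<close>.\<close>
  have hg: "\<bar>b h\<bar> < \<bar>b g\<bar>"
  proof (cases "d i = i")
    case True
    have "\<bar>b h\<bar> \<le> w i"
      using bounds[OF i] h_vote[OF True] mult_left_mono[of "\<bar>a i\<bar>" 1 "w i"]
      by (simp add: b_def abs_mult)
    also have "\<dots> < \<bar>a i\<bar> * \<bar>b g\<bar>"
      using pos gain_d' by (simp flip: abs_mult)
    also have "\<dots> \<le> \<bar>b g\<bar>"
      using bounds(2)[OF i] mult_right_mono[of "\<bar>a i\<bar>" 1 "\<bar>b g\<bar>"] by simp
    finally show ?thesis .
  next
    case False
    have "\<bar>a i\<bar> * \<bar>b h\<bar> < \<bar>a i\<bar> * \<bar>b g\<bar>"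
      using better False gain_d gain_d' h(2) gpos by (simp add: d'_def flip: abs_mult)
    then show ?thesis
      by (simp add: mult_less_cancel_left)
  qed
  \<comment> \<open>For a voter \<open>h = i\<close>, so the product is \<open>w i\<close> times a
    square; for a delegator this is admissibility.\<close>
  have sign: "0 < a i * b h" if "b h \<noteq> 0"
  proof (cases "d i = i")
    case True
    then have "a i * b h = w i * (a i)\<^sup>2" "w i \<noteq> 0" "a i \<noteq> 0"
      using h_vote that by (auto simp: b_def power2_eq_square)
    moreover from this have "0 < w i * (a i)\<^sup>2"
      using bounds(1)[OF i] by (intro mult_pos_pos) auto
    ultimately show ?thesis
      by simp
  qed (use h in auto)
  have new: "is_guru d' k f \<or> is_guru d' k g \<and> f = h" if "is_guru d k f" for k f
    using is_guru_change[OF that g] is_guru_unique[OF h(1)] by (auto simp: d'_def)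
  show "admissible N w a (d(i := j))"
    unfolding admissible_def d'_def[symmetric] b_def[symmetric]
  proof (rule ballI)
    fix k assume k: "k \<in> N"
    show "\<exists>g. is_guru d' k g \<and> (d' k \<noteq> k \<longrightarrow> 0 < a k * b g \<and> w k \<le> a k * b g)"
    proof (cases "k = i")
      case True
      then show ?thesis
        using g gpos pos gain_d' by auto
    next
      case False
      obtain f where f: "is_guru d k f"
          "d k \<noteq> k \<longrightarrow> 0 < a k * b f \<and> w k \<le> a k * b f"
        using adm k unfolding admissible_def b_def by blast
      have same: "d' k = d k"
        using False by (simp add: d'_def)
      \<comment> \<open>Agent \<open>k\<close> reached \<open>h\<close> through \<open>i\<close> and
        is carried along to \<open>g\<close>. Its own positive gain excludes \<open>b h = 0\<close>,
        so \<open>a i\<close> can serve to compare the signs of \<open>b h\<close> and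
        \<open>b g\<close>.\<close>
      have "a k * b f \<le> a k * b g" if "d k \<noteq> k" "f = h"
      proof -
        have "0 < a k * b f"
          using f(2) that by blast
        moreover from this have "0 < a i * b f"
          using sign that by (cases "b h = 0") auto
        ultimately show ?thesis
          using same_sign_mult_mono[of "a i" "b f" "a k" "b g"] gpos hg that by simp
      qed
      then show ?thesis
        using new[OF f(1)] f(2) unfolding same by fastforce
    qed
  qed
  have gd': "guru (d(i := j)) i = g"
    using guru_eqI[OF g] by (simp add: d'_def)
  show "\<bar>w (guru d i) * a (guru d i)\<bar> < \<bar>w (guru (d(i := j)) i) * a (guru (d(i := j)) i)\<bar>"
    using hg unfolding gd' guru_eqI[OF h(1)] b_def .
  show "\<bar>w (guru d k) * a (guru d k)\<bar> \<le> \<bar>w (guru (d(i := j)) k) * a (guru (d(i := j)) k)\<bar>"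
    if k: "k \<in> N" for k
  proof -
    obtain f where f: "is_guru d k f"
      using adm k unfolding admissible_def by blast
    have "guru d' k = f \<or> guru d' k = g \<and> f = h"
      using new[OF f] by (auto dest: guru_eqI)
    then show ?thesis
      using hg guru_eqI[OF f] unfolding b_def d'_def by auto
  qed
qed

section \<open>Maximising the potential over admissible profiles\<close>

lemma gain_equilibrium_exists:
  assumes N: "finite N" "\<And>i. i \<in> N \<Longrightarrow> finite (S i)" "\<And>i. i \<in> N \<Longrightarrow> i \<in> S i"
    and bounds: "\<And>i. i \<in> N \<Longrightarrow> 0 \<le> w i" "\<And>i. i \<in> N \<Longrightarrow> \<bar>a i\<bar> \<le> 1"
  shows "\<exists>d. pure_nash_equilibrium N S (gain w a) d"
proof -
  define D where "D = {d \<in> Pi\<^sub>E N S. admissible N w a d}"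
  define \<Phi> where "\<Phi> d = (\<Sum>i\<in>N. \<bar>w (guru d i) * a (guru d i)\<bar>)" for d
  have "finite D"
    unfolding D_def using N by (simp add: finite_PiE)
  \<comment> \<open>Everybody voting is admissible, so the maximum is over a nonempty set.\<close>
  moreover have "restrict (\<lambda>i. i) N \<in> D"
    using N(3) by (auto simp: D_def admissible_def intro!: exI is_guru_self)
  ultimately obtain d where d: "d \<in> D" and max: "\<And>d'. d' \<in> D \<Longrightarrow> \<Phi> d' \<le> \<Phi> d"
    using ex_is_arg_min_if_finite[of D "\<lambda>d. - \<Phi> d"] by (auto simp: is_arg_min_def not_less)
  have adm: "admissible N w a d" and dPi: "d \<in> Pi\<^sub>E N S"
    using d by (auto simp: D_def)
  have "gain w a i (d(i := j)) \<le> gain w a i d" if i: "i \<in> N" "j \<in> S i" for i j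
  proof (rule ccontr)
    assume "\<not> ?thesis"
    then have better: "gain w a i d < gain w a i (d(i := j))" by simp
    note imp = admissible_improvement[OF adm i(1) bounds better]
    have "d(i := j) \<in> D"
      unfolding D_def using imp(1) i dPi by (auto simp: PiE_iff extensional_def)
    \<comment> \<open>No summand drops, and the one of the deviating agent \<open>i\<close> grows
      strictly.\<close>
    moreover have "\<Phi> d < \<Phi> (d(i := j))"
      unfolding \<Phi>_def using imp(2,3) i N(1) by (intro sum_strict_mono_ex1) auto
    ultimately show False
      using max by fastforce
  qed
  then show ?thesis
    using dPi unfolding pure_nash_equilibrium_def by blast
qed

section \<open>Return to the delegation game\<close>

lemma utility_eq_gain:
  fixes M :: "'w measure" and \<tau> :: "'a \<Rightarrow> 'w \<Rightarrow> nat"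
  assumes "prob_space M"
    and "prob_space.indep_vars M (\<lambda>_. count_space {0, 1}) \<tau> N"
    and i: "i \<in> N" "e i = 0" and closed: "\<And>k. k \<in> N \<Longrightarrow> d k \<in> N"
  shows "utility N M \<tau> q e i d =
    (1 + gain (\<lambda>k. 2 * q k - 1) (\<lambda>k. 2 * measure M {\<omega> \<in> space M. \<tau> k \<omega> = 1} - 1) i d) / 2"
proof (cases "d i \<noteq> i \<and> (\<exists>g. is_guru d i g)")
  case True
  then obtain g where g: "is_guru d i g" and di: "d i \<noteq> i" by blast
  have gN: "g \<in> N"
    using is_guru_mem[OF g i(1) closed] .
  have "i \<noteq> g"
    using is_guru_fixed[OF g] di by auto
  note prox = proximity_indep[OF assms(1,2) i(1) gN this]
  have "i \<in> agents_with_guru N d"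
    using g i by (auto simp: agents_with_guru_def)
  \<comment> \<open>With \<open>p = x * y + (1 - x) * (1 - y)\<close> one has
    \<open>2 * p - 1 = (2 * x - 1) * (2 * y - 1)\<close>, and the left side is
    \<open>(1 + (2 * r - 1) * (2 * p - 1)) / 2\<close>.\<close>
  moreover have eq: "r * (x * y + (1 - x) * (1 - y)) + (1 - r) * (1 - (x * y + (1 - x) * (1 - y)))
      = (1 + (2 * x - 1) * ((2 * r - 1) * (2 * y - 1))) / 2" for r x y :: real
    by (simp add: field_simps)
  ultimately show ?thesis
    unfolding gain_delegate[OF g di] utility_def individual_accuracy_def guru_eqI[OF g] prox
    using di eq by (simp only: if_True if_False)
next
  case False
  then show ?thesis
    using i by (auto simp: utility_def individual_accuracy_def agents_with_guru_def gain_def)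
qed

theorem theorem2:
  fixes n :: nat and N :: "nat set" and R :: "(nat \<times> nat) set"
    and M :: "'w measure" and \<tau> :: "nat \<Rightarrow> 'w \<Rightarrow> nat" and q e :: "nat \<Rightarrow> real"
  assumes agents: "N = {1..n}"
    and network: "R \<subseteq> N \<times> N"
    and prob: "prob_space M"
    and types: "prob_space.indep_vars M (\<lambda>_. count_space {0, 1}) \<tau> N"
    and accuracy: "\<forall>i\<in>N. 1 / 2 \<le> q i \<and> q i \<le> 1"
    and effortless: "\<forall>i\<in>N. e i = 0"
  shows "\<exists>d. pure_nash_equilibrium N (strategies R) (utility N M \<tau> q e) d"
proof -
  define w where "w = (\<lambda>k. 2 * q k - 1)"
  define a where "a = (\<lambda>k. 2 * measure M {\<omega> \<in> space M. \<tau> k \<omega> = 1} - 1)"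
  have finN: "finite N"
    using agents by simp
  have sub: "strategies R i \<subseteq> N" if "i \<in> N" for i
    using that network by (auto simp: strategies_def)
  have "\<bar>a i\<bar> \<le> 1" for i
    unfolding a_def abs_le_iff using prob_space.prob_le_1[OF prob] by simp
  moreover have "0 \<le> w i" if "i \<in> N" for i
    using accuracy that by (auto simp: w_def)
  ultimately obtain d where d: "pure_nash_equilibrium N (strategies R) (gain w a) d"
    using gain_equilibrium_exists[of N "strategies R" w a] finN finite_subset[OF sub finN]
    by (auto simp: strategies_def)
  have u: "utility N M \<tau> q e i d' = (1 + gain w a i d') / 2"
    if "i \<in> N" "\<And>k. k \<in> N \<Longrightarrow> d' k \<in> N" for i d'
    unfolding w_def a_def using effortless that(1)
    by (intro utility_eq_gain[OF prob types that(1) _ that(2)]) auto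
  have closed: "d k \<in> N" if "k \<in> N" for k
    using d sub that unfolding pure_nash_equilibrium_def by blast
  \<comment> \<open>Both \<open>d\<close> and its deviations map \<open>N\<close> into itself, so
    utility is the same increasing affine function of gain on both sides.\<close>
  have "utility N M \<tau> q e i (d(i := j)) \<le> utility N M \<tau> q e i d"
    if i: "i \<in> N" "j \<in> strategies R i" for i j
  proof -
    have "utility N M \<tau> q e i (d(i := j)) = (1 + gain w a i (d(i := j))) / 2"
      using closed i sub by (intro u) auto
    moreover have "utility N M \<tau> q e i d = (1 + gain w a i d) / 2"
      using closed i by (intro u) auto
    moreover have "gain w a i (d(i := j)) \<le> gain w a i d"
      using d i unfolding pure_nash_equilibrium_def by blast
    ultimately show ?thesis
      by simp
  qed
  then have "pure_nash_equilibrium N (strategies R) (utility N M \<tau> q e) d"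
    using d unfolding pure_nash_equilibrium_def by blast
  then show ?thesis by blast
qed

end
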